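(* Let $\lambda$ be any fixed real number and let $r$ be a fixed nonnegative integer. Let $f(x)=\sum_{n=0}^{\infty}a_nx^n\in\mathbb{C}[[x]]$ and $g(x)=\sum_{k=0}^{\infty}b_kx^k\in\mathbb{C}[[x]]$. Then we have $$\sum_{n=0}^{\infty}\frac{f^{(n)}(0)}{n!}\sum_{k=0}^{n}{n+r \brace k+r}_{r,\lambda}x^{k}g^{(k)}(x)=\sum_{n=0}^{\infty}\frac{g^{(n)}(0)}{n!}f_{\lambda}(n+r)x^{n}.$$ In particular, we also have $$\sum_{m=r}^{\infty}\frac{f^{(m)}(0)}{m!}\left(\sum_{k=r}^{m}{m \brace k}_{r,\lambda}x^{k}g^{(k)}(x)\right)=\sum_{n=r}^{\infty}\frac{g^{(n)}(0)}{n!}\binom{n}{r}r!\left(\sum_{m=r}^{\infty}\frac{f^{(m)}(0)}{m!}(n)_{m-r,\lambda}\right)x^{n}.$$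
   Context: Degenerate falling factorials: $(y)_{0,\lambda}=1$ and $(y)_{n,\lambda}=y(y-\lambda)\cdots(y-(n-1)\lambda)$ for $n\ge1$; ordinary falling factorials: $(y)_0=1$ and $(y)_n=y(y-1)\cdots(y-n+1)$ for $n\ge1$. For $f(x)=\sum_{n=0}^{\infty}a_nx^n\in\mathbb{C}[[x]]$ one defines $f_\lambda(x)=\sum_{n=0}^{\infty}a_n(x)_{n,\lambda}$, so that $f_\lambda(n+r)=\sum_{m=0}^{\infty}a_m(n+r)_{m,\lambda}$. Here $f^{(n)}$ and $g^{(k)}$ denote the $n$-th and $k$-th derivatives with respect to $x$, so $f^{(n)}(0)/n!=a_n$ and $g^{(n)}(0)/n!=b_n$. For an integer $r\ge0$, the degenerate $r$-Stirling numbers of the second kind ${n+r \brace k+r}_{r,\lambda}$ ($0\le k\le n$) are defined by $(y+r)_{n,\lambda}=\sum_{k=0}^{n}{n+r \brace k+r}_{r,\lambda}(y)_{k}$ for $n\ge0$. Thus for $r\le k\le m$, ${m \brace k}_{r,\lambda}$ is the number obtained from this definition with $(n,k)$ replaced by $(m-r,k-r)$. *)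

theory Defs
  imports Complex_Main "HOL-Computational_Algebra.Formal_Power_Series"
begin

definition deg_ffact :: "real \<Rightarrow> 'a::real_field \<Rightarrow> nat \<Rightarrow> 'a" where
  "deg_ffact lam y n = (\<Prod>i<n. y - of_nat i * of_real lam)"

definition ffact :: "'a::comm_ring_1 \<Rightarrow> nat \<Rightarrow> 'a" where
  "ffact y n = (\<Prod>i<n. y - of_nat i)"

text \<open>The coefficients \<open>c 0, \<dots>, c n\<close> in the expansion of the degenerate falling factorial of
  \<open>y + r\<close> in ordinary falling factorials of \<open>y\<close>.  Setting \<open>c k = 0\<close> for \<open>k > n\<close> makes
  the family a unique function; see \<open>rstirling_coeffs_unique\<close> below.\<close>

definition is_rstirling_coeffs :: "real \<Rightarrow> nat \<Rightarrow> nat \<Rightarrow> (nat \<Rightarrow> real) \<Rightarrow> bool" where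
  "is_rstirling_coeffs lam r n c \<longleftrightarrow>
     (\<forall>y::real. deg_ffact lam (y + of_nat r) n = (\<Sum>k=0..n. c k * ffact y k)) \<and>
     (\<forall>k>n. c k = 0)"

text \<open>\<open>deg_rstirling2 lam r m k\<close> is the number written with \<open>m\<close> above \<open>k\<close> in braces, meaningful
  only for \<open>r \<le> k \<le> m\<close>: both entries carry the shift by \<open>r\<close>.\<close>

definition deg_rstirling2 :: "real \<Rightarrow> nat \<Rightarrow> nat \<Rightarrow> nat \<Rightarrow> real" where
  "deg_rstirling2 lam r m k = (THE c. is_rstirling_coeffs lam r (m - r) c) (k - r)"

lemma ffact_Suc: "ffact y (Suc n) = ffact y n * (y - of_nat n)"
  by (simp add: ffact_def)

lemma rstirling_coeffs_exist: "\<exists>c. is_rstirling_coeffs lam r n c"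
proof (induction n)
  case 0
  show ?case
    by (rule exI[of _ "\<lambda>k. if k = 0 then 1 else 0"])
       (simp add: is_rstirling_coeffs_def deg_ffact_def ffact_def)
next
  case (Suc n)
  then obtain c where
    c: "\<And>y::real. deg_ffact lam (y + of_nat r) n = (\<Sum>k=0..n. c k * ffact y k)"
    and c0: "\<And>k. k > n \<Longrightarrow> c k = 0"
    unfolding is_rstirling_coeffs_def by metis
  define d where "d k = (if k = 0 then 0 else c (k - 1)) + (real k + real r - real n * lam) * c k" for k
  have "deg_ffact lam (y + of_nat r) (Suc n) = (\<Sum>k=0..Suc n. d k * ffact y k)" for y :: real
  proof -
    have "deg_ffact lam (y + of_nat r) (Suc n)
        = (\<Sum>k=0..n. c k * ffact y k) * (y + real r - real n * lam)"
      using c[of y] by (simp add: deg_ffact_def)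
    also have "\<dots> = (\<Sum>k=0..n. c k * ffact y (Suc k))
                   + (\<Sum>k=0..n. (real k + real r - real n * lam) * c k * ffact y k)"
      unfolding sum_distrib_right sum.distrib[symmetric]
      by (rule sum.cong) (simp_all add: ffact_Suc algebra_simps)
    also have "(\<Sum>k=0..n. c k * ffact y (Suc k))
        = (\<Sum>k=0..Suc n. (if k = 0 then 0 else c (k - 1)) * ffact y k)"
      by (subst sum.atLeast0_atMost_Suc_shift) simp
    also have "(\<Sum>k=0..n. (real k + real r - real n * lam) * c k * ffact y k)
        = (\<Sum>k=0..Suc n. (real k + real r - real n * lam) * c k * ffact y k)"
      by (simp add: c0)
    finally show ?thesis
      by (simp only: d_def sum.distrib distrib_right)
  qed
  moreover have "\<forall>k>Suc n. d k = 0"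
    by (auto simp: d_def c0)
  ultimately show ?case
    unfolding is_rstirling_coeffs_def by blast
qed

lemma ffact_eq_0: "m < k \<Longrightarrow> ffact (of_nat m :: real) k = 0"
  by (auto simp: ffact_def)

lemma ffact_self_neq_0: "ffact (of_nat m :: real) m \<noteq> 0"
  by (auto simp: ffact_def)

lemma rstirling_coeffs_unique: "\<exists>!c. is_rstirling_coeffs lam r n c"
proof (rule ex_ex1I[OF rstirling_coeffs_exist])
  fix c d
  assume c: "is_rstirling_coeffs lam r n c" and d: "is_rstirling_coeffs lam r n d"
  have "c k = d k" for k
  proof (induction k rule: less_induct)
    case (less k)
    show ?case
    proof (cases "k \<le> n")
      case True
      have "(\<Sum>i=0..n. c i * ffact (real k) i) = (\<Sum>i=0..n. d i * ffact (real k) i)"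
        using c d unfolding is_rstirling_coeffs_def by metis
      then have "(\<Sum>i=0..n. (c i - d i) * ffact (real k) i) = 0"
        by (simp add: left_diff_distrib sum_subtractf)
      also have "(\<Sum>i=0..n. (c i - d i) * ffact (real k) i)
          = (\<Sum>i\<in>{k}. (c i - d i) * ffact (real k) i)"
        using True less ffact_eq_0[of k]
        by (intro sum.mono_neutral_right) (auto simp: neq_iff)
      finally show ?thesis
        using ffact_self_neq_0[of k] by simp
    next
      case False
      then have "c k = 0" "d k = 0"
        using c d unfolding is_rstirling_coeffs_def by (meson not_le)+
      then show ?thesis by simp
    qed
  qed
  then show "c = d" by blast
qed

lemma deg_rstirling2_expansion:
  "deg_ffact lam (y + of_nat r) n
     = (\<Sum>k=0..n. deg_rstirling2 lam r (n + r) (k + r) * ffact (y::real) k)"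
proof -
  define c where "c = (THE c. is_rstirling_coeffs lam r n c)"
  have "is_rstirling_coeffs lam r n c"
    unfolding c_def by (rule theI'[OF rstirling_coeffs_unique])
  moreover have "deg_rstirling2 lam r (n + r) (k + r) = c k" for k
    by (simp add: deg_rstirling2_def c_def)
  ultimately show ?thesis
    by (simp add: is_rstirling_coeffs_def)
qed

abbreviation fps_taylor :: "complex fps \<Rightarrow> nat \<Rightarrow> complex" where
  "fps_taylor f n \<equiv> fps_nth ((fps_deriv ^^ n) f) 0 / fact n"

definition deg_fun :: "real \<Rightarrow> complex fps \<Rightarrow> complex \<Rightarrow> complex" where
  "deg_fun lam f x = (\<Sum>m. fps_nth f m * deg_ffact lam x m)"

text \<open>The series defining \<open>deg_fun\<close> may diverge, and then its \<open>suminf\<close> is unspecified.\<close>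

definition deg_fun_converges :: "real \<Rightarrow> complex fps \<Rightarrow> complex \<Rightarrow> bool" where
  "deg_fun_converges lam f x \<longleftrightarrow> summable (\<lambda>m. fps_nth f m * deg_ffact lam x m)"

text \<open>Series of formal power series converge coefficientwise, each coefficient in the usual
  topology of the complex numbers.  This is weaker than convergence in the metric of the type
  \<open>fps\<close>, which would force every coefficient of the partial sums to be eventually constant.\<close>

definition fps_coeff_sums :: "(nat \<Rightarrow> complex fps) \<Rightarrow> complex fps \<Rightarrow> bool" where
  "fps_coeff_sums F S \<longleftrightarrow> (\<forall>j. (\<lambda>n. fps_nth (F n) j) sums fps_nth S j)"

definition fps_coeff_summable :: "(nat \<Rightarrow> complex fps) \<Rightarrow> bool" where
  "fps_coeff_summable F \<longleftrightarrow> (\<exists>S. fps_coeff_sums F S)"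

definition stirling_term :: "real \<Rightarrow> nat \<Rightarrow> complex fps \<Rightarrow> complex fps \<Rightarrow> nat \<Rightarrow> complex fps" where
  "stirling_term lam r f g n =
     fps_const (fps_taylor f n) *
       (\<Sum>k=0..n. fps_const (of_real (deg_rstirling2 lam r (n + r) (k + r)))
                    * fps_X ^ k * (fps_deriv ^^ k) g)"

definition stirling_term_from :: "real \<Rightarrow> nat \<Rightarrow> complex fps \<Rightarrow> complex fps \<Rightarrow> nat \<Rightarrow> complex fps" where
  "stirling_term_from lam r f g m =
     (if r \<le> m then
        fps_const (fps_taylor f m) *
          (\<Sum>k=r..m. fps_const (of_real (deg_rstirling2 lam r m k))
                       * fps_X ^ k * (fps_deriv ^^ k) g)
      else 0)"

text \<open>The factor of \<open>shifted_term\<close> depending on \<open>lam\<close> has degree \<open>m - r\<close>, not \<open>m\<close>, so its sum over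
  \<open>m\<close> is not a value of \<open>deg_fun lam f\<close>.\<close>

definition shifted_term :: "real \<Rightarrow> nat \<Rightarrow> complex fps \<Rightarrow> nat \<Rightarrow> nat \<Rightarrow> complex" where
  "shifted_term lam r f n m =
     (if r \<le> m then fps_taylor f m * deg_ffact lam (of_nat n) (m - r) else 0)"

end

theory Submission
  imports Defs
begin

text \<open>The operator \<open>x\<^sup>k (d/dx)\<^sup>k\<close> is diagonal on the monomials: it sends \<open>x\<^sup>j\<close> to \<open>(j)\<^sub>k x\<^sup>j\<close>.  So the
  coefficient of \<open>x\<^sup>j\<close> in \<open>\<Sum>k. S(n + r, k + r) x\<^sup>k g\<^sup>(\<^sup>k\<^sup>)\<close> is \<open>b\<^sub>j\<close> times \<open>\<Sum>k. S(n + r, k + r) (j)\<^sub>k\<close>, and the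
  defining expansion of the Stirling numbers, evaluated at \<open>y = j\<close>, collapses the latter sum to the
  single value \<open>(j + r)\<^bsub>n,\<lambda>\<^esub>\<close>.  In the second identity the lower index starts at \<open>r\<close>, and
  \<open>(j)\<^bsub>i+r\<^esub> = (j)\<^sub>r (j - r)\<^sub>i\<close> pulls out the factor \<open>(j)\<^sub>r = (j choose r) r!\<close>, leaving the expansion at
  \<open>y = j - r\<close>, whose value is \<open>(j)\<^bsub>m-r,\<lambda>\<^esub>\<close>.  For \<open>j < r\<close> this argument is negative, which is
  harmless: the expansion holds at every real \<open>y\<close>, and the factor \<open>(j)\<^sub>r\<close> is then \<open>0\<close>, so the
  resulting series starts at \<open>x\<^sup>r\<close>.

  In both identities the \<open>j\<close>-th coefficient of the \<open>n\<close>-th term therefore factors as \<open>c\<^sub>j u\<^bsub>j,n\<^esub>\<close>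
  (\<open>stirling_term_nth\<close>, \<open>stirling_term_from_nth\<close>).  Such a series converges coefficientwise exactly
  when each \<open>\<Sum>n. u\<^bsub>j,n\<^esub>\<close> with \<open>c\<^sub>j \<noteq> 0\<close> converges, and its sum is then read off
  (\<open>fps_coeff_summable_iff_factored\<close>, \<open>fps_coeff_sums_factored\<close>).\<close>

lemma of_real_ffact: "of_real (ffact y k) = (ffact (of_real y) k :: 'a :: real_field)"
  by (simp add: ffact_def)

lemma of_real_deg_ffact:
  "of_real (deg_ffact lam y n) = (deg_ffact lam (of_real y) n :: 'a :: real_field)"
  by (simp add: deg_ffact_def)

lemma ffact_add: "ffact y (r + i) = ffact y r * ffact (y - of_nat r) i"
  by (induction i) (simp_all add: ffact_Suc algebra_simps, simp add: ffact_def)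

lemma ffact_of_nat_eq_choose_fact:
  "ffact (of_nat j) r = (of_nat (j choose r) * fact r :: 'a :: field_char_0)"
  by (simp add: ffact_def binomial_gbinomial mult.commute gbinomial_mult_fact atLeast0LessThan)

lemma ffact_of_nat_eq_0: "j < k \<Longrightarrow> ffact (of_nat j) k = (0 :: 'a :: comm_ring_1)"
  unfolding ffact_def by (rule prod_zero) auto

lemma fps_taylor_eq_nth: "fps_taylor f n = fps_nth f n"
  by (simp add: fps_0th_higher_deriv)

lemma higher_deriv_nth:
  fixes g :: "'a :: field_char_0 fps"
  shows "fps_nth ((fps_deriv ^^ k) g) i = ffact (of_nat (i + k)) k * fps_nth g (i + k)"
proof (induction k arbitrary: i)
  case 0
  show ?case
    by (simp add: ffact_def)
next
  case (Suc k)
  then show ?case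
    by (simp add: ffact_Suc algebra_simps)
qed

text \<open>The monomials are eigenvectors of \<open>x\<^sup>k (d/dx)\<^sup>k\<close>: multiplying by \<open>x\<^sup>k\<close> undoes the shift of
  coefficients caused by \<open>k\<close> derivatives and leaves only the factor \<open>(j)\<^sub>k\<close>.\<close>

lemma X_power_higher_deriv_nth:
  fixes g :: "'a :: field_char_0 fps"
  shows "fps_nth (fps_X ^ k * (fps_deriv ^^ k) g) j = ffact (of_nat j) k * fps_nth g j"
proof (cases "j < k")
  case True
  then show ?thesis
    by (simp add: fps_X_power_mult_nth ffact_of_nat_eq_0)
next
  case False
  then show ?thesis
    by (simp add: fps_X_power_mult_nth higher_deriv_nth del: of_nat_add)
qed

text \<open>The expansion that defines the Stirling numbers is one over the reals; only real arguments
  are needed over the complex numbers, so it carries over by embedding.\<close>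

lemma deg_rstirling2_expansion_complex:
  fixes y :: real
  shows "(\<Sum>k=0..n. of_real (deg_rstirling2 lam r (n + r) (k + r)) * ffact (of_real y) k)
           = (deg_ffact lam (of_real y + of_nat r) n :: complex)"
proof -
  have "(deg_ffact lam (of_real y + of_nat r) n :: complex)
      = of_real (deg_ffact lam (y + of_nat r) n)"
    by (simp add: of_real_deg_ffact)
  then show ?thesis
    by (simp add: deg_rstirling2_expansion of_real_ffact)
qed

text \<open>On the \<open>j\<close>-th coefficient the Stirling sum acts through the eigenvalues \<open>(j)\<^sub>k\<close>, so it is the
  expansion at \<open>y = j\<close>.\<close>

lemma stirling_term_nth:
  "fps_nth (stirling_term lam r f g n) j
     = fps_nth g j * (fps_nth f n * deg_ffact lam (of_nat (j + r)) n)"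
proof -
  have "fps_nth (stirling_term lam r f g n) j
      = fps_nth f n * (\<Sum>k=0..n. of_real (deg_rstirling2 lam r (n + r) (k + r))
                                   * (ffact (of_nat j) k * fps_nth g j))"
    unfolding stirling_term_def fps_taylor_eq_nth
    by (simp add: fps_sum_nth mult.assoc X_power_higher_deriv_nth)
  also have "\<dots> = fps_nth f n * (fps_nth g j
      * (\<Sum>k=0..n. of_real (deg_rstirling2 lam r (n + r) (k + r)) * ffact (of_real (real j)) k))"
    by (simp add: sum_distrib_left mult_ac)
  also have "\<dots> = fps_nth f n * (fps_nth g j * deg_ffact lam (of_nat (j + r)) n)"
    by (simp only: deg_rstirling2_expansion_complex) simp
  finally show ?thesis
    by (simp add: mult_ac)
qed

text \<open>With \<open>k = i + r\<close> the eigenvalue splits as \<open>(j)\<^bsub>i+r\<^esub> = (j)\<^sub>r (j - r)\<^sub>i\<close>, and the remaining sum over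
  \<open>i\<close> is the expansion at \<open>y = j - r\<close>; the shift by \<open>r\<close> built into it restores the argument \<open>j\<close>.\<close>

lemma stirling_term_from_nth:
  "fps_nth (stirling_term_from lam r f g m) j
     = fps_nth g j * of_nat (j choose r) * fact r * shifted_term lam r f j m"
proof (cases "r \<le> m")
  case False
  then show ?thesis
    by (simp add: stirling_term_from_def shifted_term_def)
next
  case True
  define n where "n = m - r"
  have m: "m = n + r"
    using True by (simp add: n_def)
  have ffact_shift:
    "ffact (of_nat j) (k + r) = (ffact (of_nat j) r * ffact (of_real (real j - real r)) k :: complex)"
    for k
    using ffact_add[of "of_nat j" r k] by (simp add: add.commute)
  have "fps_nth (stirling_term_from lam r f g m) j
      = fps_nth f m * (\<Sum>k=r..m. of_real (deg_rstirling2 lam r m k)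
                                   * (ffact (of_nat j) k * fps_nth g j))"
    using True unfolding stirling_term_from_def fps_taylor_eq_nth
    by (simp add: fps_sum_nth mult.assoc X_power_higher_deriv_nth)
  also have "(\<Sum>k=r..m. of_real (deg_rstirling2 lam r m k) * (ffact (of_nat j) k * fps_nth g j))
      = (\<Sum>k=0..n. of_real (deg_rstirling2 lam r (n + r) (k + r))
                      * (ffact (of_nat j) (k + r) * fps_nth g j))"
    using sum.shift_bounds_cl_nat_ivl
      [of "\<lambda>k. of_real (deg_rstirling2 lam r m k) * (ffact (of_nat j) k * fps_nth g j)" 0 r n]
    by (simp add: m)
  also have "\<dots> = fps_nth g j * ffact (of_nat j) r
      * (\<Sum>k=0..n. of_real (deg_rstirling2 lam r (n + r) (k + r))
                      * ffact (of_real (real j - real r)) k)"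
    by (simp only: ffact_shift sum_distrib_left mult_ac)
  also have "\<dots> = fps_nth g j * ffact (of_nat j) r * deg_ffact lam (of_nat j) n"
    by (simp only: deg_rstirling2_expansion_complex) simp
  finally show ?thesis
    using True unfolding shifted_term_def fps_taylor_eq_nth ffact_of_nat_eq_choose_fact
    by (simp add: n_def mult_ac)
qed

lemma fps_coeff_summable_iff:
  "fps_coeff_summable F \<longleftrightarrow> (\<forall>j. summable (\<lambda>n. fps_nth (F n) j))"
proof
  assume "\<forall>j. summable (\<lambda>n. fps_nth (F n) j)"
  then have "fps_coeff_sums F (Abs_fps (\<lambda>j. \<Sum>n. fps_nth (F n) j))"
    by (simp add: fps_coeff_sums_def summable_sums)
  then show "fps_coeff_summable F"
    unfolding fps_coeff_summable_def by blast
qed (auto simp: fps_coeff_summable_def fps_coeff_sums_def intro: sums_summable)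

lemma fps_coeff_summable_iff_factored:
  assumes "\<And>n j. fps_nth (F n) j = c j * u j n"
  shows "fps_coeff_summable F \<longleftrightarrow> (\<forall>j. c j \<noteq> 0 \<longrightarrow> summable (u j))"
  unfolding fps_coeff_summable_iff assms summable_cmult_iff by auto

text \<open>A coefficient with \<open>c j = 0\<close> vanishes in every term, so the unspecified value of a divergent
  \<open>suminf (u j)\<close> does no harm.\<close>

lemma fps_coeff_sums_factored:
  assumes nth: "\<And>n j. fps_nth (F n) j = c j * u j n"
    and conv: "\<And>j. c j \<noteq> 0 \<Longrightarrow> summable (u j)"
  shows "fps_coeff_sums F (Abs_fps (\<lambda>j. c j * suminf (u j)))"
  unfolding fps_coeff_sums_def nth
proof
  fix j
  show "(\<lambda>n. c j * u j n) sums fps_nth (Abs_fps (\<lambda>j. c j * suminf (u j))) j"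
    using conv[of j] by (cases "c j = 0") (auto intro: sums_mult summable_sums)
qed

theorem theorem2:
  fixes lam :: real and r :: nat and f g :: "complex fps"
  shows
    "((fps_coeff_summable (stirling_term lam r f g) \<longleftrightarrow>
         (\<forall>n. fps_taylor g n \<noteq> 0 \<longrightarrow> deg_fun_converges lam f (of_nat (n + r)))) \<and>
      ((\<forall>n. fps_taylor g n \<noteq> 0 \<longrightarrow> deg_fun_converges lam f (of_nat (n + r))) \<longrightarrow>
         fps_coeff_sums (stirling_term lam r f g)
           (Abs_fps (\<lambda>n. fps_taylor g n * deg_fun lam f (of_nat (n + r)))))) \<and>
     ((fps_coeff_summable (stirling_term_from lam r f g) \<longleftrightarrow>
         (\<forall>n\<ge>r. fps_taylor g n \<noteq> 0 \<longrightarrow> summable (shifted_term lam r f n))) \<and>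
      ((\<forall>n\<ge>r. fps_taylor g n \<noteq> 0 \<longrightarrow> summable (shifted_term lam r f n)) \<longrightarrow>
         fps_coeff_sums (stirling_term_from lam r f g)
           (Abs_fps (\<lambda>n. if r \<le> n
              then fps_taylor g n * of_nat (n choose r) * fact r * (\<Sum>m. shifted_term lam r f n m)
              else 0))))"
proof -
  have first_summable:
    "fps_coeff_summable (stirling_term lam r f g) \<longleftrightarrow>
       (\<forall>n. fps_nth g n \<noteq> 0 \<longrightarrow> deg_fun_converges lam f (of_nat (n + r)))"
    unfolding deg_fun_converges_def
    by (rule fps_coeff_summable_iff_factored) (rule stirling_term_nth)
  have first_sums:
    "fps_coeff_sums (stirling_term lam r f g)
       (Abs_fps (\<lambda>n. fps_nth g n * deg_fun lam f (of_nat (n + r))))"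
    if "\<forall>n. fps_nth g n \<noteq> 0 \<longrightarrow> deg_fun_converges lam f (of_nat (n + r))"
    unfolding deg_fun_def
    by (rule fps_coeff_sums_factored, rule stirling_term_nth)
       (use that in \<open>simp add: deg_fun_converges_def\<close>)
  \<comment> \<open>The binomial coefficient makes \<open>c j\<close> vanish for \<open>j < r\<close>; this is where the restriction to
     \<open>n \<ge> r\<close> in the convergence condition and in the sum comes from.\<close>
  define c where "c j = fps_nth g j * of_nat (j choose r) * fact r" for j
  have nth: "fps_nth (stirling_term_from lam r f g m) j = c j * shifted_term lam r f j m" for m j
    by (simp add: stirling_term_from_nth c_def)
  have c_eq_0_iff: "c j = 0 \<longleftrightarrow> j < r \<or> fps_nth g j = 0" for j
    by (auto simp: c_def)
  have second_summable:
    "fps_coeff_summable (stirling_term_from lam r f g) \<longleftrightarrow>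
       (\<forall>n\<ge>r. fps_nth g n \<noteq> 0 \<longrightarrow> summable (shifted_term lam r f n))"
    using fps_coeff_summable_iff_factored[of "stirling_term_from lam r f g" c, OF nth]
    by (auto simp: c_eq_0_iff not_less)
  have second_sums:
    "fps_coeff_sums (stirling_term_from lam r f g)
       (Abs_fps (\<lambda>n. if r \<le> n
          then fps_nth g n * of_nat (n choose r) * fact r * (\<Sum>m. shifted_term lam r f n m)
          else 0))"
    if conv: "\<forall>n\<ge>r. fps_nth g n \<noteq> 0 \<longrightarrow> summable (shifted_term lam r f n)"
  proof -
    have "fps_coeff_sums (stirling_term_from lam r f g)
            (Abs_fps (\<lambda>n. c n * suminf (shifted_term lam r f n)))"
      by (rule fps_coeff_sums_factored, rule nth) (use conv in \<open>simp add: c_eq_0_iff\<close>)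
    also have "(\<lambda>n. c n * suminf (shifted_term lam r f n))
        = (\<lambda>n. if r \<le> n
             then fps_nth g n * of_nat (n choose r) * fact r * (\<Sum>m. shifted_term lam r f n m)
             else 0)"
      by (auto simp: c_def)
    finally show ?thesis .
  qed
  show ?thesis
    unfolding fps_taylor_eq_nth
    using first_summable first_sums second_summable second_sums by blast
qed

end
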